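(* For every nonnegative integer $N$, let \[ f_N(q) := \sum_{j\geq 0} q^{3j^2 -2j} {N \brack 3j}_q (q^2;q^3)_j. \] Then \[ f_{N+1}(q) = F_N(0,1,1;1) - q^N F_{N-1}(0,1,1;1). \]
   Context: Gaussian binomial: ${A\brack B}_q=0$ if $B>A$ or $B<0$, otherwise $\frac{(q;q)_A}{(q;q)_B(q;q)_{A-B}}$, with $(a;q)_n=\prod_{t=0}^{n-1}(1-aq^t)$. For integers $N$, $F_N(0,1,1;x)=0$ if $N<0$, and for $N\ge0$ \[ F_N(0,1,1;x)=\sum_{m,n\ge0}(-1)^n q^{\binom{3n+1}{2}+m^2+3mn}x^{m+3n}{N-3n-m+1\brack m}_q{N-2n-m\brack n}_{q^3}; \] $F_N(0,1,1;1)$ is its value at $x=1$. *)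

theory Defs
  imports "HOL-Library.Groups_Big_Fun"
begin

text \<open>
  The base \<open>q\<close> ranges over the elements of an arbitrary field that are not roots of unity, so
  that the quotients below never divide by zero.  This includes an indeterminate
  (\<open>q\<close> in a field of rational functions or of Laurent series) and complex \<open>q\<close> with \<open>|q| < 1\<close>.
\<close>

definition not_root_of_unity :: "'a::field \<Rightarrow> bool" where
  "not_root_of_unity q \<longleftrightarrow> (\<forall>n>0. q ^ n \<noteq> 1)"

definition qpoch :: "'a::field \<Rightarrow> 'a \<Rightarrow> nat \<Rightarrow> 'a" where
  "qpoch a q n = (\<Prod>t<n. 1 - a * q ^ t)"

text \<open>The arguments are integers, since the upper entry is negative in some terms of \<open>F011\<close>.\<close>

definition gauss_binom :: "'a::field \<Rightarrow> int \<Rightarrow> int \<Rightarrow> 'a" where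
  "gauss_binom q A B =
     (if B > A \<or> B < 0 then 0
      else qpoch q q (nat A) / (qpoch q q (nat B) * qpoch q q (nat (A - B))))"

text \<open>
  The sums are \<^const>\<open>Sum_any\<close>, the sum over all indices of a function of finite support; the
  support is finite by the two lemmas below.
\<close>

definition F011_term :: "'a::field \<Rightarrow> int \<Rightarrow> 'a \<Rightarrow> nat \<Rightarrow> nat \<Rightarrow> 'a" where
  "F011_term q N x m n =
     (-1) ^ n * q ^ (((3 * n + 1) choose 2) + m\<^sup>2 + 3 * m * n) * x ^ (m + 3 * n)
     * gauss_binom q (N - 3 * int n - int m + 1) (int m)
     * gauss_binom (q ^ 3) (N - 2 * int n - int m) (int n)"

definition F011 :: "'a::field \<Rightarrow> int \<Rightarrow> 'a \<Rightarrow> 'a" where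
  "F011 q N x = (if N < 0 then 0 else (\<Sum>(m, n). F011_term q N x m n))"

text \<open>The truncated subtraction is harmless, as \<open>2 * j \<le> 3 * j\<^sup>2\<close> for every natural number \<open>j\<close>.\<close>

definition f_term :: "'a::field \<Rightarrow> nat \<Rightarrow> nat \<Rightarrow> 'a" where
  "f_term q N j =
     q ^ (3 * j\<^sup>2 - 2 * j) * gauss_binom q (int N) (int (3 * j)) * qpoch (q\<^sup>2) (q ^ 3) j"

definition f_poly :: "'a::field \<Rightarrow> nat \<Rightarrow> 'a" where
  "f_poly q N = (\<Sum>j. f_term q N j)"

lemma finite_support_F011_term:
  "finite {p. (case p of (m, n) \<Rightarrow> F011_term q N x m n) \<noteq> 0}"
proof (rule finite_subset)
  show "{p. (case p of (m, n) \<Rightarrow> F011_term q N x m n) \<noteq> 0} \<subseteq> {..nat N} \<times> {..nat N}"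
    by (auto simp: F011_term_def gauss_binom_def split: if_splits)
qed simp

lemma finite_support_f_term: "finite {j. f_term q N j \<noteq> 0}"
proof (rule finite_subset)
  show "{j. f_term q N j \<noteq> 0} \<subseteq> {..N}"
    by (auto simp: f_term_def gauss_binom_def split: if_splits)
qed simp

end

(* Both sides are determined by recurrences in N.  The q-Pascal rules give F_N in terms of
   F_{N-1}, F_{N-2}, F_{N-3}, and at x = 1 this collapses to
   F_N = (1 + q^N) F_{N-1} - q^(2N-1) F_{N-2}.  Applying (S - 1)(S - q)(S - q^2), with S the shift of
   N, to f_N lowers 3j to 3j - 3, so that reindexing j gives back multiples of f_N and f_{N-1}.
   The combination F_N - q^N F_{N-1} satisfies the resulting recurrence for f_{N+1} and has the same
   initial values. *)

theory Submission
  imports Defs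
begin

section \<open>q-Pochhammer symbols and Gaussian binomials with integer entries\<close>

lemma qpoch_Suc: "qpoch a q (Suc n) = qpoch a q n * (1 - a * q ^ n)"
  by (simp add: qpoch_def)

lemma not_root_of_unity_power:
  assumes "not_root_of_unity q" "k > 0"
  shows "not_root_of_unity (q ^ k)"
  using assms by (simp add: not_root_of_unity_def flip: power_mult)

lemma qpoch_self_nonzero:
  assumes "not_root_of_unity q"
  shows "qpoch q q n \<noteq> 0"
  using assms by (auto simp: qpoch_def not_root_of_unity_def simp flip: power_Suc)

lemma gauss_binom_eq_0: "B > A \<or> B < 0 \<Longrightarrow> gauss_binom q A B = 0"
  by (simp add: gauss_binom_def)

lemma gauss_binom_0_right:
  assumes "not_root_of_unity q" "A \<ge> 0"
  shows "gauss_binom q A 0 = 1"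
  using assms qpoch_self_nonzero[OF assms(1)] by (simp add: gauss_binom_def qpoch_def[of _ _ 0])

lemma gauss_binom_self:
  assumes "not_root_of_unity q" "A \<ge> 0"
  shows "gauss_binom q A A = 1"
  using assms qpoch_self_nonzero[OF assms(1)] by (simp add: gauss_binom_def qpoch_def[of _ _ 0])

text \<open>Negative upper entries cause no trouble, as all three binomials vanish. The rule fails
  only at A = B = 0, where the left side is 1 but both binomials on the right have upper entry
  -1.\<close>

lemma gauss_binom_pascal:
  fixes q :: "'a::field"
  assumes q: "not_root_of_unity q" and AB: "A \<noteq> 0 \<or> B \<noteq> 0"
  shows "gauss_binom q A B
    = gauss_binom q (A - 1) B + q ^ nat (A - B) * gauss_binom q (A - 1) (B - 1)"
proof -
  consider "B > A \<or> B < 0" | "B = 0" "A > 0" | "B = A" "A > 0" | "0 < B" "B < A"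
    using AB by linarith
  then show ?thesis
  proof cases
    case 4
    define b where "b = nat (B - 1)"
    define d where "d = nat (A - B - 1)"
    have A: "A = int (Suc (Suc (b + d)))" and B: "B = int (Suc b)"
      using 4 by (auto simp: b_def d_def)
    have nz: "qpoch q q n \<noteq> 0" for n
      using q by (rule qpoch_self_nonzero)
    have pos: "1 - q * q ^ n \<noteq> 0" for n
      using nz[of "Suc n"] by (simp add: qpoch_Suc)
    have n: "nat A = Suc (Suc (b + d))" "nat B = Suc b" "nat (A - B) = Suc d"
        "nat (A - 1) = Suc (b + d)" "nat (A - 1 - B) = d" "nat (B - 1) = b"
        "nat (A - 1 - (B - 1)) = Suc d"
      using A B by auto
    show ?thesis
      using 4 nz[of b] nz[of d] pos[of b] pos[of d]
      by (simp add: gauss_binom_def n qpoch_Suc power_add divide_simps) (simp add: algebra_simps)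
  qed (use q in \<open>auto simp: gauss_binom_eq_0 gauss_binom_0_right gauss_binom_self\<close>)
qed

text \<open>Comparing last factors of the q-Pochhammer symbols gives (1 - q^(A-B)) [A, B] = (1 -
  q^A) [A-1, B]. This form trades a power of q that depends on B for a shift of A with a coefficient
  free of B.\<close>

lemma gauss_binom_absorb:
  fixes q :: "'a::field"
  assumes q: "not_root_of_unity q" and A: "A \<ge> 0"
  shows "q ^ nat (A - B) * gauss_binom q A B
    = gauss_binom q A B - (1 - q ^ nat A) * gauss_binom q (A - 1) B"
proof (cases "0 \<le> B \<and> B < A")
  case True
  define b where "b = nat B"
  define d where "d = nat (A - B - 1)"
  have A: "A = int (Suc (b + d))" and B: "B = int b"
    using True by (auto simp: b_def d_def)
  have n: "nat A = Suc (b + d)" "nat B = b" "nat (A - B) = Suc d"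
      "nat (A - 1) = b + d" "nat (A - 1 - B) = d"
    using A B by auto
  have nz: "qpoch q q n \<noteq> 0" for n
    using q by (rule qpoch_self_nonzero)
  have pos: "1 - q * q ^ d \<noteq> 0"
    using nz[of "Suc d"] by (simp add: qpoch_Suc)
  show ?thesis
    using True nz[of b] nz[of d] pos
    by (simp add: gauss_binom_def n qpoch_Suc power_add divide_simps) (simp add: algebra_simps)
next
  case False
  then show ?thesis
    using A by (auto simp: gauss_binom_eq_0)
qed

text \<open>This is the operator \<open>(S - 1) (S - q) (S - q\<^sup>2)\<close>, with \<open>S\<close> the shift of the upper entry: each
  factor lowers the lower entry by one.\<close>

lemma gauss_binom_third_difference:
  fixes q :: "'a::field"
  assumes q: "not_root_of_unity q" and A: "A \<ge> 0"
  shows "gauss_binom q (A + 3) B - (1 + q + q\<^sup>2) * gauss_binom q (A + 2) B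
      + (q + q\<^sup>2 + q ^ 3) * gauss_binom q (A + 1) B - q ^ 3 * gauss_binom q A B
    = q ^ (3 * nat (A + 3 - B)) * gauss_binom q A (B - 3)"
proof -
  define G where "G = gauss_binom q"
  have P: "G (M + 1) k - G M k = q ^ nat (M + 1 - k) * G M (k - 1)" if "M \<ge> 0" for M k
    using gauss_binom_pascal[OF q, of "M + 1" k] that by (simp add: G_def)
  \<comment> \<open>For k > M the truncation by \<open>nat\<close> would spoil the exponents, but
    then \<open>G M k\<close> is 0.\<close>
  have shift: "q ^ nat (M - k) * G M k * q = q ^ nat (M + 1 - k) * G M k" for M k
  proof (cases "k \<le> M")
    case True
    then have "nat (M + 1 - k) = Suc (nat (M - k))"
      by linarith
    then show ?thesis by simp
  qed (simp add: G_def gauss_binom_eq_0)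
  define D1 where "D1 M = G (M + 1) B - G M B" for M
  define D2 where "D2 M = D1 (M + 1) - q * D1 M" for M
  have D1: "D1 M = q ^ nat (M + 1 - B) * G M (B - 1)" if "M \<ge> 0" for M
    using P[OF that] by (simp add: D1_def)
  have D2: "D2 M = q ^ (2 * nat (M + 2 - B)) * G M (B - 2)" if "M \<ge> 0" for M
  proof -
    \<comment> \<open>Multiplication by \<open>q\<close> gives \<open>D1 M\<close> the same power as
      \<open>D1 (M + 1)\<close>. The power factors out of \<open>D2 M\<close> and leaves a first
      difference with lower entry \<open>B - 1\<close>.\<close>
    have "q * D1 M = q ^ nat (M + 2 - B) * G M (B - 1)"
      using shift[of M "B - 1"] D1[OF that] by (simp add: algebra_simps)
    then have "D2 M = q ^ nat (M + 2 - B) * (G (M + 1) (B - 1) - G M (B - 1))"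
      using D1[of "M + 1"] that by (simp add: D2_def algebra_simps)
    also have "\<dots> = q ^ nat (M + 2 - B) * (q ^ nat (M + 2 - B) * G M (B - 2))"
      using P[of M "B - 1"] that by (simp add: algebra_simps)
    finally show ?thesis
      by (simp add: mult_2 power_add)
  qed
  \<comment> \<open>\<open>D2\<close> carries the square of a power of \<open>q\<close>, so two
    factors \<open>q\<close> are needed to match \<open>D2 (A + 1)\<close>.\<close>
  have "q\<^sup>2 * D2 A = (q ^ nat (A + 2 - B) * q)\<^sup>2 * G A (B - 2)"
    using D2[OF A] by (simp add: power_mult_distrib power_even_eq mult_ac)
  also have "\<dots> = (q ^ nat (A + 3 - B))\<^sup>2 * G A (B - 2)"
    using shift[of A "B - 2"] by (cases "G A (B - 2) = 0") (simp_all add: algebra_simps)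
  finally have "D2 (A + 1) - q\<^sup>2 * D2 A
      = (q ^ nat (A + 3 - B))\<^sup>2 * (G (A + 1) (B - 2) - G A (B - 2))"
    using D2[of "A + 1"] A by (simp add: algebra_simps power_even_eq)
  also have "\<dots> = (q ^ nat (A + 3 - B))\<^sup>2 * (q ^ nat (A + 3 - B) * G A (B - 3))"
    using P[of A "B - 2"] A by (simp add: algebra_simps)
  also have "\<dots> = q ^ (3 * nat (A + 3 - B)) * G A (B - 3)"
    using power_mult[of q "nat (A + 3 - B)" 3]
    by (simp add: mult.commute power3_eq_cube power2_eq_square)
  finally show ?thesis
    by (simp add: D2_def D1_def G_def algebra_simps power2_eq_square power3_eq_cube)
qed

section \<open>The recurrence of f_N\<close>

lemma f_poly_eq_sum:
  assumes "N \<le> K"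
  shows "f_poly q N = (\<Sum>j\<le>K. f_term q N j)"
  unfolding f_poly_def
  by (rule Sum_any.expand_superset)
    (use assms in \<open>auto simp: f_term_def gauss_binom_def split: if_splits\<close>)

text \<open>After the third difference and the shift of j, the dependence of the new coefficients on
  j, relative to the old ones, reduces to a single factor q^(N-3j). Absorption trades this factor
  for a term in f_{N-1}.\<close>

lemma f_poly_rec:
  fixes q :: "'a::field"
  assumes q: "not_root_of_unity q"
  shows "f_poly q (N + 3) - (1 + q + q\<^sup>2) * f_poly q (N + 2)
      + (q + q\<^sup>2 + q ^ 3) * f_poly q (N + 1) - q ^ 3 * f_poly q N
    = q ^ (2 * N + 1) * (f_poly q N - (1 - q ^ N) * f_poly q (N - 1)) - q ^ (3 * N + 3) * f_poly q N"
    (is "?L = ?R")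
proof -
  \<comment> \<open>\<open>Suc K\<close> = \<open>N + 3\<close> bounds j for every polynomial in the
    recurrence; \<open>K\<close> is the bound left after the shift of j and still suffices for
    \<open>f_poly q N\<close>.\<close>
  define K where "K = N + 2"
  define c where "c j = q ^ (3 * j\<^sup>2 - 2 * j) * qpoch (q\<^sup>2) (q ^ 3) j" for j
  have f: "f_poly q M = (\<Sum>j\<le>Suc K. c j * gauss_binom q (int M) (int (3 * j)))"
    if "M \<le> N + 3" for M
    using f_poly_eq_sum[of M "Suc K"] that by (simp add: K_def f_term_def c_def mult_ac)
  have f': "f_poly q M = (\<Sum>j\<le>K. c j * gauss_binom q (int M) (int (3 * j)))"
    if "M \<le> N" for M
    using f_poly_eq_sum[of M K] that by (simp add: K_def f_term_def c_def mult_ac)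
  have c: "c (Suc j) = c j * q ^ (6 * j + 1) * (1 - q ^ (3 * j + 2))" for j
  proof -
    have "2 * j \<le> 3 * j\<^sup>2"
      by (cases j) (simp_all add: power2_eq_square)
    then have "3 * (Suc j)\<^sup>2 - 2 * Suc j = (3 * j\<^sup>2 - 2 * j) + (6 * j + 1)"
      by (simp add: power2_eq_square)
    moreover have "q\<^sup>2 * (q ^ 3) ^ j = q ^ (3 * j + 2)"
      by (simp add: add.commute flip: power_mult power_add)
    ultimately show ?thesis
      by (simp add: c_def qpoch_Suc power_add mult_ac)
  qed
  have "?L = (\<Sum>j\<le>Suc K. c j *
      (gauss_binom q (int N + 3) (int (3 * j)) - (1 + q + q\<^sup>2) * gauss_binom q (int N + 2) (int (3 * j))
      + (q + q\<^sup>2 + q ^ 3) * gauss_binom q (int N + 1) (int (3 * j))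
      - q ^ 3 * gauss_binom q (int N) (int (3 * j))))"
    by (simp add: f sum_distrib_left algebra_simps sum.distrib sum_subtractf)
  also have "\<dots> = (\<Sum>j\<le>Suc K. c j *
      (q ^ (3 * nat (int N + 3 - int (3 * j))) * gauss_binom q (int N) (int (3 * j) - 3)))"
    by (subst gauss_binom_third_difference[OF q]) simp_all
  \<comment> \<open>The term at j = 0 has lower entry -3 and drops out.\<close>
  also have "\<dots> = (\<Sum>j\<le>K. c (Suc j) *
      (q ^ (3 * nat (int N - int (3 * j))) * gauss_binom q (int N) (int (3 * j))))"
    by (subst sum.atMost_Suc_shift) (simp add: gauss_binom_eq_0)
  also have "\<dots> = (\<Sum>j\<le>K. c j *
      (q ^ (2 * N + 1) * (gauss_binom q (int N) (int (3 * j))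
         - (1 - q ^ N) * gauss_binom q (int (N - 1)) (int (3 * j)))
       - q ^ (3 * N + 3) * gauss_binom q (int N) (int (3 * j))))"
  proof (rule sum.cong[OF refl])
    fix j
    define e where "e = nat (int N - int (3 * j))"
    define g where "g = gauss_binom q (int N) (int (3 * j))"
    \<comment> \<open>At N = 0 the truncated \<open>N - 1\<close> differs from the integer -1, but
      the factor \<open>1 - q ^ N\<close> is then 0.\<close>
    have "(1 - q ^ N) * gauss_binom q (int N - 1) (int (3 * j))
        = (1 - q ^ N) * gauss_binom q (int (N - 1)) (int (3 * j))"
      by (cases N) simp_all
    then have absorb: "q ^ e * g = g - (1 - q ^ N) * gauss_binom q (int (N - 1)) (int (3 * j))"
      using gauss_binom_absorb[OF q, of "int N" "int (3 * j)"] by (simp add: e_def g_def)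
    \<comment> \<open>Passing from \<open>c j\<close> to \<open>c (Suc j)\<close> contributes
      q^(6j+1) - q^(9j+3). Multiplied by \<open>q ^ (3 * e)\<close> with N = 3j + e, the two
      exponents become 2N + 1 + e and 3N + 3.\<close>
    have "c (Suc j) * (q ^ (3 * e) * g) = c j * (q ^ (2 * N + 1) * (q ^ e * g) - q ^ (3 * N + 3) * g)"
    proof (cases "3 * j \<le> N")
      case True
      then have "N = 3 * j + e"
        by (auto simp: e_def)
      then have "2 * N + 1 + e = 6 * j + 1 + 3 * e" "3 * N + 3 = 6 * j + 1 + (3 * j + 2) + 3 * e"
        by simp_all
      then have "q ^ (2 * N + 1) * q ^ e = q ^ (6 * j + 1) * q ^ (3 * e)"
        "q ^ (3 * N + 3) = q ^ (6 * j + 1) * q ^ (3 * j + 2) * q ^ (3 * e)"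
        by (simp_all only: power_add[symmetric])
      moreover have "C * a * (1 - b) * (d * g) = C * (p * (u * g) - r * g)"
        if "p * u = a * d" "r = a * b * d" for C a b d p u r :: 'a
        using that by algebra
      ultimately show ?thesis
        unfolding c by blast
    qed (simp add: g_def gauss_binom_eq_0)
    then show "c (Suc j) * (q ^ (3 * nat (int N - int (3 * j))) * gauss_binom q (int N) (int (3 * j)))
      = c j * (q ^ (2 * N + 1) * (gauss_binom q (int N) (int (3 * j))
         - (1 - q ^ N) * gauss_binom q (int (N - 1)) (int (3 * j)))
       - q ^ (3 * N + 3) * gauss_binom q (int N) (int (3 * j)))"
      unfolding absorb by (simp add: e_def g_def)
  qed
  also have "\<dots> = ?R"
    by (simp add: f' sum_distrib_left algebra_simps sum.distrib sum_subtractf)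
  finally show ?thesis .
qed

section \<open>The recurrences of F_N\<close>

lemma F011_eq_sum:
  assumes "N \<le> int K"
  shows "F011 q N x = (\<Sum>m\<le>K. \<Sum>n\<le>K. F011_term q N x m n)"
proof (cases "N < 0")
  case True
  \<comment> \<open>The upper entry of the second binomial is negative, hence below
    \<open>n\<close>. The finite sum thus also represents the value at -1, which the recurrences
    reach.\<close>
  then have "F011_term q N x m n = 0" for m n
    by (simp add: F011_term_def gauss_binom_eq_0)
  with True show ?thesis
    by (simp add: F011_def)
next
  case False
  have "(\<Sum>(m, n). F011_term q N x m n) = (\<Sum>(m, n)\<in>{..K} \<times> {..K}. F011_term q N x m n)"
    by (rule Sum_any.expand_superset)
      (use assms in \<open>auto simp: F011_term_def gauss_binom_def split: if_splits\<close>)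
  with False show ?thesis
    by (simp add: F011_def sum.cartesian_product)
qed

text \<open>\<open>F011\<close> enumerates the placements in \<open>{1..N}\<close> of disjoint single points and blocks of three
  consecutive points (of sign \<open>-1\<close>), where the point just below a single point has to be free.
  In the three terms, \<open>N + 2\<close> is free, a single point, or the top of a block.\<close>

lemma F011_term_rec:
  fixes q :: "'a::field"
  assumes q: "not_root_of_unity q"
  shows "F011_term q (int N + 2) x m n = F011_term q (int N + 1) x m n
    + (case m of 0 \<Rightarrow> 0 | Suc m' \<Rightarrow> x * q ^ (N + 2) * F011_term q (int N) x m' n)
    - (case n of 0 \<Rightarrow> 0 | Suc n' \<Rightarrow> x ^ 3 * q ^ (3 * N + 3) * F011_term q (int N - 1) x m n')"
proof -
  define A where "A = int N + 2 - 3 * int n - int m + 1"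
  define B where "B = int N + 2 - 2 * int n - int m"
  define w where "w m n = (-1) ^ n * q ^ (((3 * n + 1) choose 2) + m\<^sup>2 + 3 * m * n) * x ^ (m + 3 * n)"
    for m n
  define G where "G = gauss_binom q"
  define H where "H = gauss_binom (q ^ 3)"
  have q3: "not_root_of_unity (q ^ 3)"
    using q by (simp add: not_root_of_unity_power)
  have T: "F011_term q M x k l = w k l * G (M - 3 * int l - int k + 1) (int k)
      * H (M - 2 * int l - int k) (int l)" for M k l
    by (simp add: F011_term_def w_def G_def H_def)
  \<comment> \<open>The companion factor covers the exception to the Pascal rule:
    \<open>A = 0\<close> and \<open>m = 0\<close> force N + 3 = 3n, so \<open>B - 1\<close> = n - 2
    < n.\<close>
  have pascal1: "G A (int m) * H (B - 1) (int n)
    = (G (A - 1) (int m) + q ^ nat (A - int m) * G (A - 1) (int m - 1)) * H (B - 1) (int n)"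
  proof (cases "A = 0 \<and> m = 0")
    case True
    then have "H (B - 1) (int n) = 0"
      unfolding H_def by (intro gauss_binom_eq_0) (auto simp: A_def B_def)
    then show ?thesis by simp
  next
    case False
    then show ?thesis
      using gauss_binom_pascal[OF q, of A "int m"] by (auto simp: G_def)
  qed
  \<comment> \<open>Likewise \<open>B = 0\<close> and \<open>n = 0\<close> force m = N + 2 and
    \<open>A = 1\<close>, so the first binomial vanishes.\<close>
  have pascal2: "G A (int m) * H B (int n)
    = G A (int m) * (H (B - 1) (int n) + (q ^ 3) ^ nat (B - int n) * H (B - 1) (int n - 1))"
  proof (cases "B = 0 \<and> n = 0")
    case True
    then have "G A (int m) = 0"
      unfolding G_def by (intro gauss_binom_eq_0) (auto simp: A_def B_def)
    then show ?thesis by simp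
  next
    case False
    then show ?thesis
      using gauss_binom_pascal[OF q3, of B "int n"] by (auto simp: H_def)
  qed
  have single: "w m n * (q ^ nat (A - int m) * G (A - 1) (int m - 1)) * H (B - 1) (int n)
    = (case m of 0 \<Rightarrow> 0 | Suc m' \<Rightarrow> x * q ^ (N + 2) * F011_term q (int N) x m' n)"
  proof (cases m)
    case 0
    then show ?thesis by (simp add: G_def gauss_binom_eq_0)
  next
    case (Suc k)
    \<comment> \<open>From k to m = k + 1 the exponent in \<open>w\<close> grows by 2k + 1 + 3n,
      which cancels the dependence of \<open>A - int m\<close> on k and n.\<close>
    have "w m n * q ^ nat (A - int m) = x * q ^ (N + 2) * w k n" if "int m \<le> A"
    proof -
      have "m\<^sup>2 + 3 * m * n + nat (A - int m) = N + 2 + (k\<^sup>2 + 3 * k * n)"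
        using that Suc by (simp add: A_def power2_eq_square algebra_simps nat_diff_distrib nat_add_distrib)
      then have "q ^ (m\<^sup>2 + 3 * m * n) * q ^ nat (A - int m) = q ^ (N + 2) * q ^ (k\<^sup>2 + 3 * k * n)"
        by (simp flip: power_add)
      moreover have "w m n * q ^ nat (A - int m) = (-1) ^ n * q ^ ((3 * n + 1) choose 2)
          * (q ^ (m\<^sup>2 + 3 * m * n) * q ^ nat (A - int m)) * x ^ (m + 3 * n)"
        by (simp add: w_def power_add mult_ac)
      ultimately show ?thesis
        by (simp add: w_def Suc power_add mult_ac)
    qed
    moreover have "G (A - 1) (int m - 1) = 0" if "\<not> int m \<le> A"
      using that by (simp add: G_def gauss_binom_eq_0)
    moreover have "F011_term q (int N) x k n = w k n * G (A - 1) (int m - 1) * H (B - 1) (int n)"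
      by (simp add: T A_def B_def Suc algebra_simps)
    ultimately show ?thesis
      by (cases "int m \<le> A") (simp_all add: Suc mult.assoc[symmetric])
  qed
  have triple: "w m n * G A (int m) * ((q ^ 3) ^ nat (B - int n) * H (B - 1) (int n - 1))
    = - (case n of 0 \<Rightarrow> 0 | Suc n' \<Rightarrow> x ^ 3 * q ^ (3 * N + 3) * F011_term q (int N - 1) x m n')"
  proof (cases n)
    case 0
    then show ?thesis by (simp add: H_def gauss_binom_eq_0)
  next
    case (Suc k)
    have "w m n * (q ^ 3) ^ nat (B - int n) = - (x ^ 3 * q ^ (3 * N + 3) * w m k)" if "int n \<le> B"
    proof -
      \<comment> \<open>The increment is (3k+1) + (3k+2) + (3k+3), the weight of three consecutive
        points.\<close>
      have "((3 * n + 1) choose 2) = ((3 * k + 1) choose 2) + 9 * k + 6"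
        by (simp add: Suc numeral_eq_Suc)
      then have "((3 * n + 1) choose 2) + m\<^sup>2 + 3 * m * n + 3 * nat (B - int n)
          = 3 * N + 3 + (((3 * k + 1) choose 2) + m\<^sup>2 + 3 * m * k)"
        using that Suc by (simp add: B_def algebra_simps)
      then have "q ^ (((3 * n + 1) choose 2) + m\<^sup>2 + 3 * m * n) * (q ^ 3) ^ nat (B - int n)
          = q ^ (3 * N + 3) * q ^ (((3 * k + 1) choose 2) + m\<^sup>2 + 3 * m * k)"
        by (simp only: power_add[symmetric] power_mult[symmetric])
      moreover have "x ^ (m + 3 * n) = x ^ 3 * x ^ (m + 3 * k)"
        by (simp add: Suc add_ac flip: power_add)
      ultimately show ?thesis
        by (simp add: w_def Suc mult_ac)
    qed
    moreover have "H (B - 1) (int n - 1) = 0" if "\<not> int n \<le> B"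
      using that by (simp add: H_def gauss_binom_eq_0)
    moreover have "F011_term q (int N - 1) x m k = w m k * G A (int m) * H (B - 1) (int n - 1)"
      by (simp add: T A_def B_def Suc algebra_simps)
    ultimately show ?thesis
      by (cases "int n \<le> B") (simp_all add: Suc mult_ac)
  qed
  have "F011_term q (int N + 2) x m n = w m n * (G A (int m) * H B (int n))"
    by (simp add: T A_def B_def mult.assoc)
  also have "\<dots> = w m n * (G A (int m) * H (B - 1) (int n))
      + w m n * G A (int m) * ((q ^ 3) ^ nat (B - int n) * H (B - 1) (int n - 1))"
    unfolding pascal2 by (simp add: algebra_simps)
  also have "w m n * (G A (int m) * H (B - 1) (int n)) = w m n * G (A - 1) (int m) * H (B - 1) (int n)
      + w m n * (q ^ nat (A - int m) * G (A - 1) (int m - 1)) * H (B - 1) (int n)"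
    unfolding pascal1 by (simp add: algebra_simps)
  also have "w m n * G (A - 1) (int m) * H (B - 1) (int n) = F011_term q (int N + 1) x m n"
    by (simp add: T A_def B_def algebra_simps)
  finally show ?thesis
    unfolding single triple by simp
qed

lemma F011_rec:
  fixes q :: "'a::field"
  assumes q: "not_root_of_unity q"
  shows "F011 q (int N + 2) x = F011 q (int N + 1) x + x * q ^ (N + 2) * F011 q (int N) x
    - x ^ 3 * q ^ (3 * N + 3) * F011 q (int N - 1) x"
proof -
  define T where "T = F011_term q"
  \<comment> \<open>\<open>Suc K\<close> = \<open>N + 2\<close> bounds m and n for all the indices
    involved. Lowering m or n by one leaves the bound \<open>K\<close>, beyond which the terms of
    the two lower sums vanish.\<close>
  define K where "K = N + 1"
  have zero: "T M x m n = 0" if "M \<le> int N" "m > K \<or> n > K" for M m n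
    using that by (auto simp: T_def F011_term_def K_def gauss_binom_eq_0)
  have F: "F011 q M x = (\<Sum>m\<le>Suc K. \<Sum>n\<le>Suc K. T M x m n)" if "M \<le> int N + 2" for M
    using that F011_eq_sum[of M "Suc K" q x] by (simp add: K_def T_def)
  have sum_shift: "(\<Sum>n\<le>Suc K. case n of 0 \<Rightarrow> 0 | Suc n' \<Rightarrow> h n') = (\<Sum>n\<le>K. h n)"
    for h :: "nat \<Rightarrow> 'a"
    by (subst sum.atMost_Suc_shift) simp
  have 1: "F011 q (int N) x = (\<Sum>m\<le>K. \<Sum>n\<le>Suc K. T (int N) x m n)"
    by (subst F) (simp_all add: zero)
  have 2: "F011 q (int N - 1) x = (\<Sum>m\<le>Suc K. \<Sum>n\<le>K. T (int N - 1) x m n)"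
    by (subst F) (simp_all add: zero)
  have "F011 q (int N + 2) x = F011 q (int N + 1) x
    + (\<Sum>m\<le>Suc K. \<Sum>n\<le>Suc K. case m of 0 \<Rightarrow> 0 | Suc m' \<Rightarrow> x * q ^ (N + 2) * T (int N) x m' n)
    - (\<Sum>m\<le>Suc K. \<Sum>n\<le>Suc K. case n of 0 \<Rightarrow> 0
         | Suc n' \<Rightarrow> x ^ 3 * q ^ (3 * N + 3) * T (int N - 1) x m n')"
    using F[of "int N + 2"] F[of "int N + 1"]
    by (simp only: T_def F011_term_rec[OF q] sum.distrib sum_subtractf)
  also have "(\<Sum>m\<le>Suc K. \<Sum>n\<le>Suc K. case m of 0 \<Rightarrow> 0 | Suc m' \<Rightarrow> x * q ^ (N + 2) * T (int N) x m' n)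
      = x * q ^ (N + 2) * F011 q (int N) x"
    unfolding 1 by (subst sum.atMost_Suc_shift) (simp del: sum.atMost_Suc add: sum_distrib_left)
  also have "(\<Sum>m\<le>Suc K. \<Sum>n\<le>Suc K. case n of 0 \<Rightarrow> 0
         | Suc n' \<Rightarrow> x ^ 3 * q ^ (3 * N + 3) * T (int N - 1) x m n')
      = x ^ 3 * q ^ (3 * N + 3) * F011 q (int N - 1) x"
    unfolding 2 sum_shift by (simp only: sum_distrib_left)
  finally show ?thesis .
qed

lemma F011_0:
  assumes "not_root_of_unity q"
  shows "F011 q 0 x = 1"
  using F011_eq_sum[of 0 0 q x] assms
  by (simp add: F011_term_def gauss_binom_0_right not_root_of_unity_power binomial_eq_0)

lemma F011_1:
  assumes "not_root_of_unity q"
  shows "F011 q 1 x = 1 + x * q"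
  using F011_eq_sum[of 1 1 q x] assms
  by (simp add: F011_term_def gauss_binom_0_right gauss_binom_self gauss_binom_eq_0
      not_root_of_unity_power binomial_eq_0)

text \<open>At \<open>x = 1\<close> the order drops to two: the difference of the two sides is multiplied by
  \<open>- q ^ (N + 2)\<close> when \<open>N\<close> increases by one.\<close>

lemma F011_at_1_rec:
  fixes q :: "'a::field"
  assumes q: "not_root_of_unity q"
  shows "F011 q (int N + 1) 1
    = (1 + q ^ (N + 1)) * F011 q (int N) 1 - q ^ (2 * N + 1) * F011 q (int N - 1) 1"
proof (induction N)
  case 0
  show ?case
    by (simp add: F011_0[OF q] F011_1[OF q] F011_def[of q "- 1"])
next
  case (Suc N)
  define Q where "Q = q ^ N"
  have pow: "q ^ (N + 1) = q * Q" "q ^ (2 * N + 1) = q * Q\<^sup>2" "q ^ (N + 2) = q\<^sup>2 * Q"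
      "q ^ (3 * N + 3) = q ^ 3 * Q ^ 3" "q ^ (Suc N + 1) = q\<^sup>2 * Q" "q ^ (2 * Suc N + 1) = q ^ 3 * Q\<^sup>2"
    by (simp_all add: Q_def power_add power_mult mult_ac eval_nat_numeral power_mult_distrib)
  have int: "int (Suc N) = int N + 1" "int N + 1 + 1 = int N + 2" "int N + 1 - 1 = int N"
    by simp_all
  \<comment> \<open>The unfolded claim is a polynomial identity in \<open>q\<close>,
    \<open>Q\<close> and the values of F at N and N - 1.\<close>
  show ?case
    unfolding int F011_rec[OF q] Suc.IH pow power_one mult_1_left by algebra
qed

section \<open>Initial values and the final induction\<close>

lemma f_poly_less_3:
  assumes "not_root_of_unity q" "N < 3"
  shows "f_poly q N = 1"
  using f_poly_eq_sum[of N 2 q] assms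
  by (simp add: f_term_def gauss_binom_0_right gauss_binom_eq_0 qpoch_def numeral_2_eq_2)

theorem theorem4p1:
  fixes q :: "'a::field" and N :: nat
  assumes "not_root_of_unity q"
  shows "f_poly q (N + 1) = F011 q (int N) 1 - q ^ N * F011 q (int N - 1) 1"
proof (induction N rule: less_induct)
  case (less N)
  \<comment> \<open>The shift by one moves the index -1 to the natural number 0.\<close>
  define F where "F n = F011 q (int n - 1) 1" for n
  have F_rec: "F (n + 2) = (1 + q ^ (n + 1)) * F (n + 1) - q ^ (2 * n + 1) * F n" for n
    using F011_at_1_rec[OF assms, of n] by (simp add: F_def algebra_simps)
  have F0: "F 0 = 0" and F1: "F 1 = 1" and F2: "F 2 = 1 + q"
    by (simp_all add: F_def F011_def[of q "- 1"] F011_0[OF assms] F011_1[OF assms])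
  have f012: "f_poly q 0 = 1" "f_poly q 1 = 1" "f_poly q 2 = 1"
    by (simp_all add: f_poly_less_3[OF assms])
  have IH: "f_poly q (n + 1) = F (n + 1) - q ^ n * F n" if "n < N" for n
    using less.IH[OF that] by (simp add: F_def)
  have "f_poly q (N + 1) = F (N + 1) - q ^ N * F N"
  \<comment> \<open>The recurrence for \<open>f_poly q (N + 1)\<close> reaches back to
    \<open>f_poly q (N - 3)\<close>, so the induction hypothesis is used at N - 4; the first four
    cases are computed directly.\<close>
  proof (cases "N < 4")
    case True
    have "F 3 = (1 + q\<^sup>2) * F 2 - q ^ 3 * F 1" "F 4 = (1 + q ^ 3) * F 3 - q ^ 5 * F 2"
      using F_rec[of 1] F_rec[of 2] by (simp_all add: numeral_eq_Suc)
    then have F3: "F 3 = 1 + q + q\<^sup>2" and F4: "F 4 = (1 + q ^ 3) * (1 + q + q\<^sup>2) - q ^ 5 * (1 + q)"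
      unfolding F1 F2 by algebra+
    have f3: "f_poly q 3 = 1 + q - q ^ 3"
      using f_poly_rec[OF assms, of 0] by (simp add: f_poly_less_3[OF assms] algebra_simps power2_eq_square)
    have f4: "f_poly q 4 = (1 + q + q\<^sup>2) * f_poly q 3 - (q + q\<^sup>2 + q ^ 3) + q ^ 3 + q ^ 4 - q ^ 6"
      using f_poly_rec[OF assms, of 1] by (simp add: f_poly_less_3[OF assms] algebra_simps eval_nat_numeral)
    from True consider "N = 0" | "N = 1" | "N = 2" | "N = 3" by linarith
    moreover have "f_poly q 1 = F 1 - F 0" "f_poly q 2 = F 2 - q * F 1"
        "f_poly q 3 = F 3 - q\<^sup>2 * F 2" "f_poly q 4 = F 4 - q ^ 3 * F 3"
      unfolding F0 F1 F2 F4 F3 f012 f4 f3 by algebra+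
    ultimately show ?thesis
      by cases (simp_all add: numeral_eq_Suc)
  next
    case False
    then obtain n where N: "N = n + 4"
      by (metis add.commute le_Suc_ex not_less)
    define Q where "Q = q ^ n"
    have f: "f_poly q (n + 1) = F (n + 1) - Q * F n"
        "f_poly q (n + 2) = F (n + 2) - q * Q * F (n + 1)"
        "f_poly q (n + 3) = F (n + 3) - q\<^sup>2 * Q * F (n + 2)"
        "f_poly q (n + 4) = F (n + 4) - q ^ 3 * Q * F (n + 3)"
      using IH[of n] IH[of "n + 1"] IH[of "n + 2"] IH[of "n + 3"]
      by (simp_all add: N Q_def power_add algebra_simps eval_nat_numeral)
    have f5: "f_poly q (n + 5) = (1 + q + q\<^sup>2) * f_poly q (n + 4)
        - (q + q\<^sup>2 + q ^ 3) * f_poly q (n + 3) + q ^ 3 * f_poly q (n + 2)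
        + q ^ 5 * Q\<^sup>2 * (f_poly q (n + 2) - (1 - q\<^sup>2 * Q) * f_poly q (n + 1))
        - q ^ 9 * Q ^ 3 * f_poly q (n + 2)"
      using f_poly_rec[OF assms, of "n + 2"]
      by (simp add: Q_def power_add power_mult algebra_simps eval_nat_numeral)
    have F: "F (n + 5) = (1 + q ^ 4 * Q) * F (n + 4) - q ^ 7 * Q\<^sup>2 * F (n + 3)"
        "F (n + 4) = (1 + q ^ 3 * Q) * F (n + 3) - q ^ 5 * Q\<^sup>2 * F (n + 2)"
        "F (n + 3) = (1 + q\<^sup>2 * Q) * F (n + 2) - q ^ 3 * Q\<^sup>2 * F (n + 1)"
        "F (n + 2) = (1 + q * Q) * F (n + 1) - q * Q\<^sup>2 * F n"
      using F_rec[of "n + 3"] F_rec[of "n + 2"] F_rec[of "n + 1"] F_rec[of n]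
      by (simp_all add: Q_def power_add power_mult algebra_simps eval_nat_numeral)
    \<comment> \<open>Eliminating with \<open>F\<close> reduces both sides to polynomials in
      \<open>q\<close>, \<open>Q\<close>, \<open>F n\<close> and \<open>F (n + 1)\<close>.\<close>
    have "f_poly q (n + 5) = F (n + 5) - q ^ 4 * Q * F (n + 4)"
      unfolding f5 f F by algebra
    then show ?thesis
      by (simp add: N Q_def power_add algebra_simps)
  qed
  then show ?case
    by (simp add: F_def)
qed

end
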